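(* For every integer $n\geq0$, $$P_{4n+1}=s_2\sum_{i=0}^n(-1)^i\binom{2n-i}{i}(h_0h_1)^{n-i}s_3^{2i}-s_1\sum_{i=0}^{n-1}(-1)^i\binom{2n-1-i}{i}h_1(h_0h_1)^{n-i-1}s_3^{2i+1},$$ $$P_{4n+3}=s_2\sum_{i=0}^{n}(-1)^i\binom{2n+1-i}{i}h_0(h_0h_1)^{n-i}s_3^{2i}-s_1\sum_{i=0}^n(-1)^i\binom{2n-i}{i}(h_0h_1)^{n-i}s_3^{2i+1}.$$
   Context: The odd $*$-Pell polynomials $P_{2n+1}\in\mathbb Z[s_1,s_2,s_3]$, $n\ge0$, are defined by $P_1=s_2$, $P_3=s_1^2s_2-s_1s_3-s_2^2$, and $P_{2n+3}=h_nP_{2n+1}-s_3^2P_{2n-1}$ for $n\ge1$, where $h_n=s_2^2-s_1s_3$ if $n$ is odd and $h_n=s_1^2-s_2$ if $n$ is even. In particular $h_0=s_1^2-s_2$ and $h_1=s_2^2-s_1s_3$. Empty sums are zero. *)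

theory Defs
  imports "HOL-Library.Poly_Mapping"
begin

datatype var = S1 | S2 | S3

text \<open>
  The polynomial ring \<open>\<int>[s\<^sub>1, s\<^sub>2, s\<^sub>3]\<close>: finitely supported maps from exponent vectors
  to integer coefficients, with the convolution product of \<^theory>\<open>HOL-Library.Poly_Mapping\<close>.
\<close>
type_synonym poly3 = "(var \<Rightarrow>\<^sub>0 nat) \<Rightarrow>\<^sub>0 int"

definition indet :: "var \<Rightarrow> poly3" where
  "indet x = Poly_Mapping.single (Poly_Mapping.single x 1) 1"

abbreviation s\<^sub>1 :: poly3 where "s\<^sub>1 \<equiv> indet S1"
abbreviation s\<^sub>2 :: poly3 where "s\<^sub>2 \<equiv> indet S2"
abbreviation s\<^sub>3 :: poly3 where "s\<^sub>3 \<equiv> indet S3"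

definition h :: "nat \<Rightarrow> poly3" where
  "h n = (if odd n then s\<^sub>2^2 - s\<^sub>1 * s\<^sub>3 else s\<^sub>1^2 - s\<^sub>2)"

text \<open>Only the odd-indexed \<open>*\<close>-Pell polynomials are needed: \<open>odd_star_pell n\<close> is \<open>P\<^bsub>2n+1\<^esub>\<close>.\<close>
fun odd_star_pell :: "nat \<Rightarrow> poly3" where
  "odd_star_pell 0 = s\<^sub>2"
| "odd_star_pell (Suc 0) = s\<^sub>1^2 * s\<^sub>2 - s\<^sub>1 * s\<^sub>3 - s\<^sub>2^2"
| "odd_star_pell (Suc (Suc n)) =
     h (Suc n) * odd_star_pell (Suc n) - s\<^sub>3^2 * odd_star_pell n"

end

theory Submission
  imports Defs
begin

text \<open>
  Put \<open>w = h\<^sub>0 h\<^sub>1\<close> and \<open>t = s\<^sub>3\<^sup>2\<close>. Consecutive coefficients of the recurrence alternate between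
  \<open>h\<^sub>0\<close> and \<open>h\<^sub>1\<close>, so its solutions are combinations of continuants of alternating sequences.
  Such a continuant of length \<open>m\<close> selects \<open>i\<close> disjoint pairs of neighbours among \<open>m\<close> positions,
  which is possible in \<open>(m - i) choose i\<close> ways. Each pair replaces one \<open>h\<^sub>0\<close> and one \<open>h\<^sub>1\<close> by \<open>-t\<close>.
  For even \<open>m\<close> the continuant is therefore a polynomial in \<open>w\<close> and \<open>t\<close>; for odd \<open>m\<close> it is such a
  polynomial times the coefficient that occurs once more than the other. These polynomials are
  \<open>reduced_continuant\<close>, and every sum in the theorem is one of
  them up to factors \<open>h\<^sub>0\<close>, \<open>h\<^sub>1\<close> or \<open>s\<^sub>3\<close>, or is empty.

  Pascal's rule gives the two-step recurrences \<open>reduced_continuant_even_step\<close> and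
  \<open>reduced_continuant_odd_step\<close>, in which \<open>w\<close> appears as a coefficient only at every second step.
  Since \<open>P\<^sub>1 = s\<^sub>2\<close> and \<open>P\<^sub>3 = h\<^sub>0 s\<^sub>2 - s\<^sub>1 s\<^sub>3\<close>, the polynomial \<open>P\<^bsub>2m+1\<^esub>\<close> is \<open>s\<^sub>2\<close> times a continuant of
  length \<open>m\<close> minus \<open>s\<^sub>1 s\<^sub>3\<close> times one of length \<open>m - 1\<close>, the latter being \<open>0\<close> for \<open>m = 0\<close>.
  Induction over two steps at a time, one for each parity, proves this.
\<close>

definition reduced_continuant :: "'a::comm_ring_1 \<Rightarrow> 'a \<Rightarrow> nat \<Rightarrow> 'a" where
  "reduced_continuant w t m =
     (\<Sum>i = 0..m div 2. (-1)^i * of_nat ((m - i) choose i) * w^(m div 2 - i) * t^i)"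

lemma reduced_continuant_0 [simp]: "reduced_continuant w t 0 = 1"
  and reduced_continuant_1 [simp]: "reduced_continuant w t (Suc 0) = 1"
  by (simp_all add: reduced_continuant_def)

text \<open>
  Both recurrences apply Pascal's rule to the binomial coefficient of each term with positive
  index: one part continues the sum for \<open>m - 1\<close>, the other, after an index shift, is \<open>-t\<close> times the
  sum for \<open>m - 2\<close>. The factor \<open>w\<close> appears when \<open>m\<close> is even because \<open>m div 2\<close> then exceeds
  \<open>(m - 1) div 2\<close>.
\<close>

lemma reduced_continuant_even_step:
  "reduced_continuant w t (2 * n + 2)
     = w * reduced_continuant w t (2 * n + 1) - t * reduced_continuant w t (2 * n)"
proof -
  let ?F = "\<lambda>i. (-1)^i * of_nat ((2 * n + 2 - i) choose i) * w^(n + 1 - i) * t^i"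
  let ?f = "\<lambda>i. (-1)^i * of_nat ((2 * n + 1 - i) choose i) * w^(n + 1 - i) * t^i"
  let ?g = "\<lambda>i. (-1)^i * of_nat ((2 * n - i) choose i) * w^(n - i) * t^i"
  have pascal: "?F (Suc i) = ?f (Suc i) - t * ?g i" if "i \<le> n" for i
  proof -
    have "2 * n + 2 - Suc i = Suc (2 * n - i)" "2 * n + 1 - Suc i = 2 * n - i"
      using that by simp_all
    then show ?thesis by (simp add: algebra_simps)
  qed
  have "reduced_continuant w t (2 * n + 2)
      = (\<Sum>i = 0..Suc n. ?F i)"
    by (simp add: reduced_continuant_def)
  also have "\<dots> = ?F 0 + (\<Sum>i = 0..n. ?F (Suc i))"
    by (simp only: sum.atLeast0_atMost_Suc_shift o_def)
  also have "(\<Sum>i = 0..n. ?F (Suc i)) = (\<Sum>i = 0..n. ?f (Suc i) - t * ?g i)"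
    by (intro sum.cong refl pascal) simp
  also have "?F 0 + \<dots> = (?f 0 + (\<Sum>i = 0..n. ?f (Suc i))) - t * (\<Sum>i = 0..n. ?g i)"
    by (simp add: sum_subtractf sum_distrib_left)
  also have "?f 0 + (\<Sum>i = 0..n. ?f (Suc i)) = (\<Sum>i = 0..Suc n. ?f i)"
    by (simp only: sum.atLeast0_atMost_Suc_shift o_def)
  \<comment> \<open>The term at the new upper end vanishes because its binomial coefficient is \<open>n choose (n + 1)\<close>.\<close>
  also have "(\<Sum>i = 0..Suc n. ?f i) = (\<Sum>i = 0..n. ?f i)"
    by (simp add: binomial_eq_0)
  also have "\<dots> = w * reduced_continuant w t (2 * n + 1)"
    unfolding reduced_continuant_def sum_distrib_left
    by (intro sum.cong) (auto simp: Suc_diff_le algebra_simps)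
  finally show ?thesis by (simp add: reduced_continuant_def)
qed

lemma reduced_continuant_odd_step:
  "reduced_continuant w t (2 * n + 3)
     = reduced_continuant w t (2 * n + 2) - t * reduced_continuant w t (2 * n + 1)"
proof -
  let ?F = "\<lambda>i. (-1)^i * of_nat ((2 * n + 3 - i) choose i) * w^(n + 1 - i) * t^i"
  let ?f = "\<lambda>i. (-1)^i * of_nat ((2 * n + 2 - i) choose i) * w^(n + 1 - i) * t^i"
  let ?g = "\<lambda>i. (-1)^i * of_nat ((2 * n + 1 - i) choose i) * w^(n - i) * t^i"
  have half: "(2 * n + 3) div 2 = Suc n" by simp
  have pascal: "?F (Suc i) = ?f (Suc i) - t * ?g i" if "i \<le> n" for i
  proof -
    have "2 * n + 3 - Suc i = Suc (2 * n + 1 - i)" "2 * n + 2 - Suc i = 2 * n + 1 - i"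
      using that by simp_all
    then show ?thesis by (simp add: algebra_simps)
  qed
  have "reduced_continuant w t (2 * n + 3)
      = (\<Sum>i = 0..Suc n. ?F i)"
    unfolding reduced_continuant_def half by simp
  also have "\<dots> = ?F 0 + (\<Sum>i = 0..n. ?F (Suc i))"
    by (simp only: sum.atLeast0_atMost_Suc_shift o_def)
  also have "(\<Sum>i = 0..n. ?F (Suc i)) = (\<Sum>i = 0..n. ?f (Suc i) - t * ?g i)"
    by (intro sum.cong refl pascal) simp
  also have "?F 0 + \<dots> = (?f 0 + (\<Sum>i = 0..n. ?f (Suc i))) - t * (\<Sum>i = 0..n. ?g i)"
    by (simp add: sum_subtractf sum_distrib_left)
  also have "?f 0 + (\<Sum>i = 0..n. ?f (Suc i)) = (\<Sum>i = 0..Suc n. ?f i)"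
    by (simp only: sum.atLeast0_atMost_Suc_shift o_def)
  finally show ?thesis by (simp add: reduced_continuant_def)
qed

lemma h_parity: "h (2 * n) = h 0" "h (Suc (2 * n)) = h 1"
  by (simp_all add: h_def)

text \<open>
  Pairing \<open>P\<^bsub>4n+3\<^esub>\<close> with \<open>P\<^bsub>4n+5\<^esub>\<close> rather than with \<open>P\<^bsub>4n+1\<^esub>\<close> avoids a continuant of length \<open>2 n - 1\<close>,
  which is negative for \<open>n = 0\<close>.
\<close>

lemma odd_star_pell_eq_reduced_continuant:
  fixes n :: nat
  defines "K \<equiv> reduced_continuant (h 0 * h 1) (s\<^sub>3^2)"
  shows "odd_star_pell (2 * n + 1) = s\<^sub>2 * (h 0 * K (2 * n + 1)) - s\<^sub>1 * (s\<^sub>3 * K (2 * n))"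
    and "odd_star_pell (2 * n + 2) = s\<^sub>2 * K (2 * n + 2) - s\<^sub>1 * (s\<^sub>3 * (h 1 * K (2 * n + 1)))"
proof (induction n)
  case 0
  have K2: "K 2 = h 0 * h 1 - s\<^sub>3^2"
    using reduced_continuant_even_step[of "h 0 * h 1" "s\<^sub>3^2" 0] by (simp add: K_def numeral_2_eq_2)
  case 1
  show ?case by (simp add: K_def h_def algebra_simps power2_eq_square)
  case 2
  have "odd_star_pell 2 = h 1 * odd_star_pell 1 - s\<^sub>3^2 * odd_star_pell 0"
    by (simp add: numeral_2_eq_2)
  also have "odd_star_pell 1 = s\<^sub>2 * h 0 - s\<^sub>1 * s\<^sub>3"
    by (simp add: h_def algebra_simps power2_eq_square)
  finally have "odd_star_pell 2 = s\<^sub>2 * K 2 - s\<^sub>1 * (s\<^sub>3 * h 1)"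
    by (simp add: K2 algebra_simps)
  then show ?case by (simp add: K_def numeral_2_eq_2)
next
  case (Suc n)
  have even_step: "K (2 * k + 2) = h 0 * h 1 * K (2 * k + 1) - s\<^sub>3^2 * K (2 * k)" for k
    unfolding K_def by (rule reduced_continuant_even_step)
  have odd_step: "K (2 * n + 3) = K (2 * n + 2) - s\<^sub>3^2 * K (2 * n + 1)"
    unfolding K_def by (rule reduced_continuant_odd_step)
  have rec1: "odd_star_pell (2 * n + 3)
      = h 0 * odd_star_pell (2 * n + 2) - s\<^sub>3^2 * odd_star_pell (2 * n + 1)"
    using h_parity(1)[of "Suc n"] by (simp add: numeral_3_eq_3)
  have rec2: "odd_star_pell (2 * n + 4)
      = h 1 * odd_star_pell (2 * n + 3) - s\<^sub>3^2 * odd_star_pell (2 * n + 2)"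
    using h_parity(2)[of "Suc n"] by (simp add: eval_nat_numeral)
  have P3: "odd_star_pell (2 * n + 3)
      = s\<^sub>2 * (h 0 * K (2 * n + 3)) - s\<^sub>1 * (s\<^sub>3 * K (2 * n + 2))"
    unfolding rec1 Suc.IH odd_step even_step by (simp add: algebra_simps)
  have K4: "K (2 * n + 4) = h 0 * h 1 * K (2 * n + 3) - s\<^sub>3^2 * K (2 * n + 2)"
    using even_step[of "Suc n"] by (simp add: eval_nat_numeral)
  have P4: "odd_star_pell (2 * n + 4)
      = s\<^sub>2 * K (2 * n + 4) - s\<^sub>1 * (s\<^sub>3 * (h 1 * K (2 * n + 3)))"
    unfolding rec2 P3 K4 Suc.IH(2) odd_step by (simp add: algebra_simps)
  have shift: "2 * Suc n + 1 = 2 * n + 3" "2 * Suc n = 2 * n + 2" "2 * n + 2 + 2 = 2 * n + 4"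
    "2 * n + 2 + 1 = 2 * n + 3"
    by simp_all
  case 1 show ?case unfolding shift by (rule P3)
  case 2 show ?case unfolding shift by (rule P4)
qed

theorem theorem9p4:
  fixes n :: nat
  shows "odd_star_pell (2 * n) =
      s\<^sub>2 * (\<Sum>i = 0..n. (-1)^i * of_nat ((2 * n - i) choose i) * (h 0 * h 1)^(n - i) * s\<^sub>3^(2 * i))
    - s\<^sub>1 * (\<Sum>i = 0..<n. (-1)^i * of_nat ((2 * n - 1 - i) choose i) * h 1 * (h 0 * h 1)^(n - i - 1) * s\<^sub>3^(2 * i + 1))
    \<and> odd_star_pell (2 * n + 1) =
      s\<^sub>2 * (\<Sum>i = 0..n. (-1)^i * of_nat ((2 * n + 1 - i) choose i) * h 0 * (h 0 * h 1)^(n - i) * s\<^sub>3^(2 * i))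
    - s\<^sub>1 * (\<Sum>i = 0..n. (-1)^i * of_nat ((2 * n - i) choose i) * (h 0 * h 1)^(n - i) * s\<^sub>3^(2 * i + 1))"
proof -
  define K where "K = reduced_continuant (h 0 * h 1) (s\<^sub>3^2)"
  have even_sum:
    "(\<Sum>i = 0..n. (-1)^i * of_nat ((2 * n - i) choose i) * (h 0 * h 1)^(n - i) * s\<^sub>3^(2 * i)) = K (2 * n)"
    by (simp add: K_def reduced_continuant_def power_mult)
  have even_sum_s3:
    "(\<Sum>i = 0..n. (-1)^i * of_nat ((2 * n - i) choose i) * (h 0 * h 1)^(n - i) * s\<^sub>3^(2 * i + 1))
       = s\<^sub>3 * K (2 * n)"
    unfolding even_sum[symmetric] sum_distrib_left by (intro sum.cong) (simp_all add: mult_ac)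
  have odd_sum_h0:
    "(\<Sum>i = 0..n. (-1)^i * of_nat ((2 * n + 1 - i) choose i) * h 0 * (h 0 * h 1)^(n - i) * s\<^sub>3^(2 * i))
       = h 0 * K (2 * n + 1)"
    unfolding K_def reduced_continuant_def sum_distrib_left
    by (intro sum.cong) (simp_all add: mult_ac flip: power_mult)
  have odd_sum_h1:
    "(\<Sum>i = 0..<n. (-1)^i * of_nat ((2 * n - 1 - i) choose i) * h 1 * (h 0 * h 1)^(n - i - 1) * s\<^sub>3^(2 * i + 1))
       = s\<^sub>3 * (h 1 * K (2 * m + 1))" if "n = Suc m" for m
    unfolding K_def reduced_continuant_def sum_distrib_left that
    by (intro sum.cong) (auto simp: mult_ac simp flip: power_mult)
  have "odd_star_pell (2 * n) = s\<^sub>2 * K (2 * n)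
    - s\<^sub>1 * (\<Sum>i = 0..<n. (-1)^i * of_nat ((2 * n - 1 - i) choose i) * h 1 * (h 0 * h 1)^(n - i - 1) * s\<^sub>3^(2 * i + 1))"
  proof (cases n)
    case 0
    then show ?thesis by (simp add: K_def)
  next
    case (Suc m)
    show ?thesis
      unfolding odd_sum_h1[OF Suc]
      using odd_star_pell_eq_reduced_continuant(2)[of m] by (simp add: Suc K_def)
  qed
  then show ?thesis
    unfolding even_sum even_sum_s3 odd_sum_h0
    using odd_star_pell_eq_reduced_continuant(1)[of n] by (simp add: K_def)
qed

end
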